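(* Let $\mathbf{k}$ be a field, let $A$ be a finitely generated $\mathbf{k}$-algebra which is a domain, let $\mathfrak{v}:A\setminus\{0\}\to\mathbb{Q}^r$ be a valuation, and let $\mathcal{B}=\{b_1,\dots,b_n\}\subset A$ be an algebra generating set. Consider the statements: (1) $\mathfrak{v}$ is a subductive valuation with respect to $\mathcal{B}$; (2) $\mathfrak{v}$ has an adapted basis $\mathbb{B}$ consisting of monomials in $\mathcal{B}$; (3) $\mathfrak{v}$ coincides with the weight valuation $\mathfrak{v}_M$ for the matrix $M\in\mathbb{Q}^{r\times n}$ with column vectors $\mathfrak{v}(b_1),\dots,\mathfrak{v}(b_n)$; (4) $\mathfrak{v}$ has Khovanskii basis $\mathcal{B}$. Then $(1)\Rightarrow(2)\Rightarrow(3)\Rightarrow(4)$.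
   Context: Valuations: $\mathbb{Q}^r$ is equipped with a total ordering $\succ$ compatible with addition. A valuation over $\mathbf{k}$ is a map $\mathfrak{v}:A\setminus\{0\}\to\mathbb{Q}^r$ (with discrete image) with $\mathfrak{v}(f+g)\succeq\min\{\mathfrak{v}(f),\mathfrak{v}(g)\}$ (if $f+g\ne0$), $\mathfrak{v}(fg)=\mathfrak{v}(f)+\mathfrak{v}(g)$, and $\mathfrak{v}(cf)=\mathfrak{v}(f)$ for $0\neq c\in\mathbf{k}$. Put $F_{\mathfrak{v}\succeq a}=\{f\ne0\mid\mathfrak{v}(f)\succeq a\}\cup\{0\}$, similarly $F_{\mathfrak{v}\succ a}$, and $\mathrm{gr}_{\mathfrak{v}}(A)=\bigoplus_aF_{\mathfrak{v}\succeq a}/F_{\mathfrak{v}\succ a}$; $\bar f$ denotes the class of $f\ne0$ in $F_{\mathfrak{v}\succeq a}/F_{\mathfrak{v}\succ a}$ with $a=\mathfrak{v}(f)$. $\mathcal{B}$ is a Khovanskii basis for $(A,\mathfrak{v})$ if the images $\bar b$, $b\in\mathcal{B}$, generate $\mathrm{gr}_{\mathfrak{v}}(A)$ as an algebra. Subduction algorithm for $0\ne f\in A$ with respect to a Khovanskii basis $\mathcal{B}$: (i) find a polynomial $p$ (all of whose monomials $b^\alpha$ have value $\mathfrak{v}(f)$) with $\bar f=p(\bar b_1,\dots,\bar b_n)$, so that $f=p(b_1,\dots,b_n)$ or $\mathfrak{v}(f-p(b_1,\dots,b_n))\succ\mathfrak{v}(f)$; (ii) if $f=p(b_1,\dots,b_n)$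 stop; otherwise replace $f$ by $f-p(b_1,\dots,b_n)$ and go to (i). $\mathfrak{v}$ is subductive with respect to $\mathcal{B}$ if $\mathcal{B}$ is a Khovanskii basis and this algorithm always terminates in finitely many steps for every $f\in A$. A $\mathbf{k}$-vector space basis $\mathbb{B}$ of $A$ is adapted to $\mathfrak{v}$ if $F_{\mathfrak{v}\succeq a}\cap\mathbb{B}$ is a vector space basis of $F_{\mathfrak{v}\succeq a}$ for all $a$ (equivalently, the image of $\mathbb{B}$ in $\mathrm{gr}_{\mathfrak{v}}(A)$ is a vector space basis). Weight (quasi)valuation: let $\pi:\mathbf{k}[x_1,\dots,x_n]\to A$, $x_i\mapsto b_i$. For $M\in\mathbb{Q}^{r\times n}$ and $0\neq p=\sum c_\alpha x^\alpha$ set $\tilde{\mathfrak{v}}_M(p)=\min\{M\alpha\mid c_\alpha\ne0\}$, and for $0\ne f\in A$ set $\mathfrak{v}_M(f)=\max\{\tilde{\mathfrak{v}}_M(\tilde f)\mid\pi(\tilde f)=f\}$ ($\min$, $\max$ with respect to $\succ$). Statement (3) means that this maximum exists and equals $\mathfrak{v}(f)$ for every $0\neq f\in A$. *)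

theory Defs
  imports
    "HOL-Analysis.Analysis"
    "HOL-Algebra.Module"
    "HOL-Library.Poly_Mapping"
    "HOL-Library.Set_Algebras"
begin

section \<open>Valuations\<close>

locale ordered_rat_vec = linorder leq lt
  for leq lt :: "rat ^ 'r \<Rightarrow> rat ^ 'r \<Rightarrow> bool" +
  assumes add_mono_le: "leq a b \<Longrightarrow> leq (a + c) (b + c)"

text \<open>The class \<^class>\<open>idom\<close> makes the algebra a commutative domain.\<close>

locale domain_algebra = vector_space scl
  for scl :: "'k::field \<Rightarrow> 'a::idom \<Rightarrow> 'a" +
  assumes scale_mult_assoc: "scl c (x * y) = scl c x * y"

text \<open>
  A valuation is only meaningful on nonzero elements: \<open>v 0\<close> is arbitrary and never used.
  Discreteness refers to the Euclidean topology; since \<^typ>\<open>rat\<close> carries no topology in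
  the library, the image is transported to \<^typ>\<open>real ^ 'r\<close>.
\<close>

locale valuation = ordered_rat_vec leq lt + domain_algebra scl
  for leq lt :: "rat ^ 'r \<Rightarrow> rat ^ 'r \<Rightarrow> bool"
    and scl :: "'k::field \<Rightarrow> 'a::idom \<Rightarrow> 'a"
    and v :: "'a \<Rightarrow> rat ^ 'r" +
  assumes discrete_image:
      "discrete ((\<lambda>f. (\<chi> i. of_rat (v f $ i)) :: real ^ 'r) ` (UNIV - {0}))"
    and v_add: "\<lbrakk>f \<noteq> 0; g \<noteq> 0; f + g \<noteq> 0\<rbrakk> \<Longrightarrow> leq (ord.min leq (v f) (v g)) (v (f + g))"
    and v_mult: "\<lbrakk>f \<noteq> 0; g \<noteq> 0\<rbrakk> \<Longrightarrow> v (f * g) = v f + v g"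
    and v_scale: "\<lbrakk>c \<noteq> 0; f \<noteq> 0\<rbrakk> \<Longrightarrow> v (scl c f) = v f"

definition F_ge :: "(rat ^ 'r \<Rightarrow> rat ^ 'r \<Rightarrow> bool) \<Rightarrow> ('a::zero \<Rightarrow> rat ^ 'r) \<Rightarrow> rat ^ 'r \<Rightarrow> 'a set"
  where "F_ge leq v a = {f. f \<noteq> 0 \<and> leq a (v f)} \<union> {0}"

definition F_gt :: "(rat ^ 'r \<Rightarrow> rat ^ 'r \<Rightarrow> bool) \<Rightarrow> ('a::zero \<Rightarrow> rat ^ 'r) \<Rightarrow> rat ^ 'r \<Rightarrow> 'a set"
  where "F_gt lt v a = {f. f \<noteq> 0 \<and> lt a (v f)} \<union> {0}"


section \<open>The associated graded algebra\<close>

definition gr_component ::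
    "(rat ^ 'r \<Rightarrow> rat ^ 'r \<Rightarrow> bool) \<Rightarrow> (rat ^ 'r \<Rightarrow> rat ^ 'r \<Rightarrow> bool) \<Rightarrow>
     ('a::comm_ring_1 \<Rightarrow> rat ^ 'r) \<Rightarrow> rat ^ 'r \<Rightarrow> 'a set set"
  where "gr_component leq lt v a = (\<lambda>f. f +o F_gt lt v a) ` F_ge leq v a"

text \<open>The class of \<open>f\<close> in degree \<open>a\<close>, as an element of the direct sum.\<close>

definition gr_class ::
    "(rat ^ 'r \<Rightarrow> rat ^ 'r \<Rightarrow> bool) \<Rightarrow> ('a::comm_ring_1 \<Rightarrow> rat ^ 'r) \<Rightarrow>
     rat ^ 'r \<Rightarrow> 'a \<Rightarrow> (rat ^ 'r \<Rightarrow> 'a set)"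
  where "gr_class lt v a f = (\<lambda>d. if d = a then f +o F_gt lt v a else F_gt lt v d)"

text \<open>The class of \<open>f \<noteq> 0\<close> in degree \<open>v f\<close>.\<close>

definition initial_form ::
    "(rat ^ 'r \<Rightarrow> rat ^ 'r \<Rightarrow> bool) \<Rightarrow> ('a::comm_ring_1 \<Rightarrow> rat ^ 'r) \<Rightarrow> 'a \<Rightarrow> (rat ^ 'r \<Rightarrow> 'a set)"
  where "initial_form lt v f = gr_class lt v (v f) f"

text \<open>
  An element of the direct sum is a family of cosets, almost all of them zero (the zero of
  degree \<open>a\<close> is \<open>F_gt lt v a\<close>). The operations \<open>+\<close>, \<open>*\<close> and \<open>\<Sum>\<close> on cosets are the elementwise
  operations on sets. In each degree the elementwise results lie in a single coset;
  adding the zero coset makes them equal to that coset. So multiplication is the bilinear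
  extension of \<open>(f + F_gt a) (g + F_gt b) = f g + F_gt (a + b)\<close>.
\<close>

definition gr_algebra ::
    "(rat ^ 'r \<Rightarrow> rat ^ 'r \<Rightarrow> bool) \<Rightarrow> (rat ^ 'r \<Rightarrow> rat ^ 'r \<Rightarrow> bool) \<Rightarrow>
     ('k::field \<Rightarrow> 'a::comm_ring_1 \<Rightarrow> 'a) \<Rightarrow> ('a \<Rightarrow> rat ^ 'r) \<Rightarrow> ('k, rat ^ 'r \<Rightarrow> 'a set) module"
  where "gr_algebra leq lt scl v =
    \<lparr> carrier = {X. (\<forall>a. X a \<in> gr_component leq lt v a) \<and> finite {a. X a \<noteq> F_gt lt v a}},
      monoid.mult = (\<lambda>X Y d. (\<Sum>a | X a \<noteq> F_gt lt v a. X a * Y (d - a)) + F_gt lt v d),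
      one = gr_class lt v 0 1,
      ring.zero = F_gt lt v,
      add = (\<lambda>X Y d. X d + Y d),
      smult = (\<lambda>c X d. scl c ` X d + F_gt lt v d) \<rparr>"


section \<open>Generation of algebras\<close>

inductive_set alg_generated :: "('k, 'b, 'm) module_scheme \<Rightarrow> 'b set \<Rightarrow> 'b set"
  for R (structure) and S :: "'b set" where
  incl: "x \<in> S \<Longrightarrow> x \<in> alg_generated R S"
| zero: "\<zero> \<in> alg_generated R S"
| one: "\<one> \<in> alg_generated R S"
| add: "\<lbrakk>x \<in> alg_generated R S; y \<in> alg_generated R S\<rbrakk> \<Longrightarrow> x \<oplus> y \<in> alg_generated R S"
| mult: "\<lbrakk>x \<in> alg_generated R S; y \<in> alg_generated R S\<rbrakk> \<Longrightarrow> x \<otimes> y \<in> alg_generated R S"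
| smult: "x \<in> alg_generated R S \<Longrightarrow> c \<odot> x \<in> alg_generated R S"

definition type_algebra :: "('k::field \<Rightarrow> 'a::comm_ring_1 \<Rightarrow> 'a) \<Rightarrow> ('k, 'a) module"
  where "type_algebra scl =
    \<lparr> carrier = UNIV, monoid.mult = (*), one = 1, ring.zero = 0, add = (+), smult = scl \<rparr>"

definition algebra_generating_set :: "('k::field \<Rightarrow> 'a::comm_ring_1 \<Rightarrow> 'a) \<Rightarrow> 'a set \<Rightarrow> bool"
  where "algebra_generating_set scl B \<longleftrightarrow> alg_generated (type_algebra scl) B = UNIV"

definition khovanskii_basis ::
    "(rat ^ 'r \<Rightarrow> rat ^ 'r \<Rightarrow> bool) \<Rightarrow> (rat ^ 'r \<Rightarrow> rat ^ 'r \<Rightarrow> bool) \<Rightarrow>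
     ('k::field \<Rightarrow> 'a::comm_ring_1 \<Rightarrow> 'a) \<Rightarrow> ('a \<Rightarrow> rat ^ 'r) \<Rightarrow> 'a set \<Rightarrow> bool"
  where "khovanskii_basis leq lt scl v B \<longleftrightarrow>
    alg_generated (gr_algebra leq lt scl v) (initial_form lt v ` B)
      = carrier (gr_algebra leq lt scl v)"


section \<open>Polynomials\<close>

text \<open>
  The polynomial ring in variables indexed by a finite type \<open>'n\<close> is
  \<^typ>\<open>('n \<Rightarrow>\<^sub>0 nat) \<Rightarrow>\<^sub>0 'k\<close>; \<^const>\<open>Poly_Mapping.keys\<close> gives the exponents of nonzero terms.
\<close>

type_synonym ('n, 'k) mpoly = "('n \<Rightarrow>\<^sub>0 nat) \<Rightarrow>\<^sub>0 'k"

definition monomial_in :: "('n::finite \<Rightarrow> 'a::comm_ring_1) \<Rightarrow> ('n \<Rightarrow>\<^sub>0 nat) \<Rightarrow> 'a"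
  where "monomial_in b \<alpha> = (\<Prod>i\<in>UNIV. b i ^ Poly_Mapping.lookup \<alpha> i)"

definition poly_subst ::
    "('k::field \<Rightarrow> 'a::comm_ring_1 \<Rightarrow> 'a) \<Rightarrow> ('n::finite \<Rightarrow> 'a) \<Rightarrow> ('n, 'k) mpoly \<Rightarrow> 'a"
  where "poly_subst scl b p =
    (\<Sum>\<alpha>\<in>Poly_Mapping.keys p. scl (Poly_Mapping.lookup p \<alpha>) (monomial_in b \<alpha>))"

definition poly_subst_in ::
    "('k::field, 'b, 'm) module_scheme \<Rightarrow> ('n::finite \<Rightarrow> 'b) \<Rightarrow> ('n, 'k) mpoly \<Rightarrow> 'b"
  where "poly_subst_in R g p =
    (\<Oplus>\<^bsub>R\<^esub>\<alpha>\<in>Poly_Mapping.keys p. Poly_Mapping.lookup p \<alpha> \<odot>\<^bsub>R\<^esub>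
       (\<Otimes>\<^bsub>R\<^esub>i\<in>UNIV. g i [^]\<^bsub>R\<^esub> Poly_Mapping.lookup \<alpha> i))"


section \<open>Subduction\<close>

text \<open>
  One pass of the subduction algorithm, from \<open>f\<close> to the remainder \<open>g\<close>. The choice of
  \<open>p\<close> is not unique, so this is a relation. The algorithm stops when the remainder is zero.
\<close>

definition subduction_step ::
    "(rat ^ 'r \<Rightarrow> rat ^ 'r \<Rightarrow> bool) \<Rightarrow> (rat ^ 'r \<Rightarrow> rat ^ 'r \<Rightarrow> bool) \<Rightarrow>
     ('k::field \<Rightarrow> 'a::comm_ring_1 \<Rightarrow> 'a) \<Rightarrow> ('a \<Rightarrow> rat ^ 'r) \<Rightarrow> ('n::finite \<Rightarrow> 'a) \<Rightarrow>
     'a \<Rightarrow> 'a \<Rightarrow> bool"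
  where "subduction_step leq lt scl v b f g \<longleftrightarrow> f \<noteq> 0 \<and>
    (\<exists>p. (\<forall>\<alpha>\<in>Poly_Mapping.keys p. v (monomial_in b \<alpha>) = v f) \<and>
         initial_form lt v f
           = poly_subst_in (gr_algebra leq lt scl v) (\<lambda>i. initial_form lt v (b i)) p \<and>
         g = f - poly_subst scl b p)"

text \<open>The algorithm always terminates if no sequence of choices leads to an infinite run.\<close>

definition subductive ::
    "(rat ^ 'r \<Rightarrow> rat ^ 'r \<Rightarrow> bool) \<Rightarrow> (rat ^ 'r \<Rightarrow> rat ^ 'r \<Rightarrow> bool) \<Rightarrow>
     ('k::field \<Rightarrow> 'a::comm_ring_1 \<Rightarrow> 'a) \<Rightarrow> ('a \<Rightarrow> rat ^ 'r) \<Rightarrow> ('n::finite \<Rightarrow> 'a) \<Rightarrow> bool"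
  where "subductive leq lt scl v b \<longleftrightarrow>
    khovanskii_basis leq lt scl v (range b) \<and>
    (\<forall>f. f \<noteq> 0 \<longrightarrow>
       \<not> (\<exists>s. s 0 = f \<and> (\<forall>m::nat. subduction_step leq lt scl v b (s m) (s (Suc m)))))"


section \<open>Adapted bases\<close>

definition vs_basis :: "('k::field \<Rightarrow> 'a::ab_group_add \<Rightarrow> 'a) \<Rightarrow> 'a set \<Rightarrow> 'a set \<Rightarrow> bool"
  where "vs_basis scl S V \<longleftrightarrow> \<not> module.dependent scl S \<and> module.span scl S = V"

definition adapted_basis ::
    "(rat ^ 'r \<Rightarrow> rat ^ 'r \<Rightarrow> bool) \<Rightarrow> ('k::field \<Rightarrow> 'a::comm_ring_1 \<Rightarrow> 'a) \<Rightarrow>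
     ('a \<Rightarrow> rat ^ 'r) \<Rightarrow> 'a set \<Rightarrow> bool"
  where "adapted_basis leq scl v S \<longleftrightarrow>
    vs_basis scl S UNIV \<and> (\<forall>a. vs_basis scl (F_ge leq v a \<inter> S) (F_ge leq v a))"


section \<open>Weight valuations\<close>

text \<open>Only meaningful for \<open>p \<noteq> 0\<close>, where the minimum is over a nonempty finite set.\<close>

definition weight_poly ::
    "(rat ^ 'r \<Rightarrow> rat ^ 'r \<Rightarrow> bool) \<Rightarrow> rat ^ 'n ^ 'r \<Rightarrow> ('n::finite, 'k::zero) mpoly \<Rightarrow> rat ^ 'r"
  where "weight_poly leq M p =
    linorder.Min leq ((\<lambda>\<alpha>. M *v (\<chi> i. of_nat (Poly_Mapping.lookup \<alpha> i))) ` Poly_Mapping.keys p)"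

text \<open>The maximum defining the weight valuation of \<open>f \<noteq> 0\<close> exists and equals \<open>m\<close>.\<close>

definition weight_val_is ::
    "(rat ^ 'r \<Rightarrow> rat ^ 'r \<Rightarrow> bool) \<Rightarrow> ('k::field \<Rightarrow> 'a::comm_ring_1 \<Rightarrow> 'a) \<Rightarrow>
     ('n::finite \<Rightarrow> 'a) \<Rightarrow> rat ^ 'n ^ 'r \<Rightarrow> 'a \<Rightarrow> rat ^ 'r \<Rightarrow> bool"
  where "weight_val_is leq scl b M f m \<longleftrightarrow>
    m \<in> {weight_poly leq M p | p. poly_subst scl b p = f} \<and>
    (\<forall>m' \<in> {weight_poly leq M p | p. poly_subst scl b p = f}. leq m' m)"

end

theory Submission
  imports Defs
begin

text \<open>
  All three implications compare an element \<open>f\<close> with the monomials of the same value. The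
  bridge is that the degree \<open>a\<close> part of the graded algebra is \<open>Fge a / Fgt a\<close>: for a polynomial
  whose monomials all have value \<open>a\<close>, evaluation at the initial forms gives the class of the
  evaluation at \<open>b\<close> (\<open>poly_subst_in_gr\<close>). A pass of the subduction algorithm on \<open>f\<close> therefore
  subtracts a combination of monomials of value \<open>v f\<close> such that the remainder lies in
  \<open>Fgt (v f)\<close> (\<open>subduction_stepI\<close>).

  From subductive to adapted: for a Khovanskii basis the monomials of value \<open>a\<close> span \<open>Fge a\<close>
  modulo \<open>Fgt a\<close> (\<open>khovanskii_basis_approximation\<close>), so some of them represent a basis of the
  quotient (\<open>exists_monomials_independent_mod_Fgt\<close>). Collect these over all \<open>a\<close> into one set
  \<open>S\<close>. It is independent because in a linear relation the terms of least value would be a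
  relation modulo terms of larger value (\<open>independent_Union_graded\<close>). If some element of
  \<open>Fge a\<close> were outside the span of \<open>Fge a \<inter> S\<close>, one pass of subduction that only uses monomials
  in \<open>S\<close> would leave a remainder with the same property; repeating this gives an infinite run,
  contrary to termination.

  From adapted to weight valuation: every polynomial expression of \<open>f\<close> has a monomial of value
  at most \<open>v f\<close>, by the ultrametric inequality, and the expansion of \<open>f\<close> in an adapted basis of
  monomials only uses values at least \<open>v f\<close>. The value of a monomial is its weight, since \<open>v\<close> is
  multiplicative.

  From weight valuation to Khovanskii basis: choose a polynomial for \<open>f\<close> whose weight is \<open>v f\<close>.
  The class of \<open>f\<close> in degree \<open>v f\<close> is the sum of the classes of its terms; a term of larger
  value contributes zero, and a term of value \<open>v f\<close> contributes a scalar multiple of a product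
  of initial forms of generators. Homogeneous elements generate the whole direct sum.
\<close>

section \<open>Filtrations by a valuation\<close>

context ordered_rat_vec
begin

lemma add_le_less:
  assumes "leq a c" "lt d e"
  shows "lt (a + d) (c + e)"
proof -
  have "leq (a + d) (c + d)"
    using add_mono_le assms by blast
  moreover have "leq (d + c) (e + c)"
    using add_mono_le assms less_imp_le by blast
  moreover have "d + c \<noteq> e + c"
    using assms by auto
  ultimately show ?thesis
    by (metis add.commute antisym_conv2 le_less_trans)
qed

lemma add_le_le: "leq a c \<Longrightarrow> leq d e \<Longrightarrow> leq (a + d) (c + e)"
  by (metis add_le_less add_mono_le le_less)

end

context domain_algebra
begin

lemma mult_scale_right: "x * scl c y = scl c (x * y)"
  by (metis mult.commute scale_mult_assoc)

lemma span_times_span: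
  assumes x: "x \<in> span S" and y: "y \<in> span T"
    and prod: "\<And>s t. s \<in> S \<Longrightarrow> t \<in> T \<Longrightarrow> s * t \<in> U"
  shows "x * y \<in> span U"
proof -
  have "s * y \<in> span U" if "s \<in> S" for s
    using y
    by (induction rule: span_induct_alt)
      (auto simp: mult_scale_right distrib_left span_zero
        intro!: span_add span_scale intro: span_base prod that)
  with x show ?thesis
    by (induction rule: span_induct_alt)
      (auto simp: scale_mult_assoc[symmetric] distrib_right span_zero intro!: span_add span_scale)
qed

end

context valuation
begin

abbreviation "Fge \<equiv> F_ge leq v"
abbreviation "Fgt \<equiv> F_gt lt v"

lemma v_add_ge:
  assumes "f \<noteq> 0" "g \<noteq> 0" "f + g \<noteq> 0" "leq a (v f)" "leq a (v g)"
  shows "leq a (v (f + g))"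
  using v_add[OF assms(1-3)] assms(4,5)
  by (auto simp: ord.min_def split: if_splits intro: order_trans)

lemma v_add_gt:
  assumes "f \<noteq> 0" "g \<noteq> 0" "f + g \<noteq> 0" "lt a (v f)" "lt a (v g)"
  shows "lt a (v (f + g))"
  using v_add[OF assms(1-3)] assms(4,5)
  by (auto simp: ord.min_def split: if_splits intro: less_le_trans)

lemma subspace_Fge: "subspace (Fge a)"
  unfolding subspace_def F_ge_def
  using v_add_ge v_scale by auto

lemma subspace_Fgt: "subspace (Fgt a)"
  unfolding subspace_def F_gt_def
  using v_add_gt v_scale by auto

lemma zero_in_F: "0 \<in> Fge a" "0 \<in> Fgt a"
  by (auto simp: F_ge_def F_gt_def)

lemma Fgt_subset_Fge: "Fgt a \<subseteq> Fge a"
  by (auto simp: F_ge_def F_gt_def less_imp_le)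

lemma Fge_antimono: "leq a c \<Longrightarrow> Fge c \<subseteq> Fge a"
  by (auto simp: F_ge_def intro: order_trans)

lemma Fge_mult: "f \<in> Fge a \<Longrightarrow> g \<in> Fge c \<Longrightarrow> f * g \<in> Fge (a + c)"
  by (auto simp: F_ge_def v_mult add_le_le)

lemma Fge_Fgt_mult: "f \<in> Fge a \<Longrightarrow> g \<in> Fgt c \<Longrightarrow> f * g \<in> Fgt (a + c)"
  by (auto simp: F_ge_def F_gt_def v_mult add_le_less)

lemma Fgt_Fge_mult: "f \<in> Fgt a \<Longrightarrow> g \<in> Fge c \<Longrightarrow> f * g \<in> Fgt (a + c)"
  using Fge_Fgt_mult[of g c f a] by (simp add: mult.commute add.commute)

lemma v_one: "v 1 = 0"
  using v_mult[of 1 1] by simp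

lemma v_power: "f \<noteq> 0 \<Longrightarrow> v (f ^ m) $ j = of_nat m * (v f $ j)"
  by (induction m) (simp_all add: v_one v_mult algebra_simps)

lemma v_prod:
  assumes "finite I" "\<And>i. i \<in> I \<Longrightarrow> f i \<noteq> 0"
  shows "v (prod f I) = (\<Sum>i\<in>I. v (f i))"
  using assms by (induction I rule: finite_induct) (auto simp: v_one v_mult)


section \<open>Elements of the graded algebra as families of representatives\<close>

text \<open>
  Every element of the direct sum has this form for some \<open>x\<close> with \<open>x d \<in> Fge d\<close> in all degrees;
  computing with representatives turns the operations on cosets into operations in the algebra.
\<close>

definition coset_family :: "(rat ^ 'r \<Rightarrow> 'a) \<Rightarrow> (rat ^ 'r \<Rightarrow> 'a set)"
  where "coset_family x = (\<lambda>d. x d +o Fgt d)"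

lemma coset_eq_iff:
  assumes "subspace W"
  shows "x +o W = y +o W \<longleftrightarrow> x - y \<in> W"
proof
  assume "x +o W = y +o W"
  moreover have "x + 0 \<in> x +o W"
    using subspace_0[OF assms] by (rule set_plus_intro2)
  ultimately obtain w where "w \<in> W" "x = y + w"
    by (auto simp: elt_set_plus_def)
  then show "x - y \<in> W"
    by simp
next
  assume d: "x - y \<in> W"
  have "u +o W \<subseteq> z +o W" if "u - z \<in> W" for u z
  proof
    fix t assume "t \<in> u +o W"
    then obtain w where w: "w \<in> W" "t = u + w"
      by (auto simp: elt_set_plus_def)
    then have "t = z + ((u - z) + w)"
      by simp
    with w that show "t \<in> z +o W"
      unfolding elt_set_plus_def using subspace_add[OF assms] by blast
  qed
  from this[OF d] this[of y x] subspace_neg[OF assms d] show "x +o W = y +o W"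
    by auto
qed

lemma coset_family_cong_iff: "coset_family x d = coset_family y d \<longleftrightarrow> x d - y d \<in> Fgt d"
  by (simp add: coset_family_def coset_eq_iff subspace_Fgt)

lemma coset_family_eq_zero_iff: "coset_family x d = Fgt d \<longleftrightarrow> x d \<in> Fgt d"
  using coset_family_cong_iff[of x d "\<lambda>_. 0"] by (simp add: coset_family_def)

lemma gr_class_eq: "gr_class lt v a f = coset_family (\<lambda>d. if d = a then f else 0)"
  by (auto simp: gr_class_def coset_family_def fun_eq_iff)

text \<open>
  The elementwise operations on cosets may give a proper part of the expected coset;
  this is why the zero coset is added in the operations of the graded algebra.
\<close>

lemma part_of_coset_plus:
  assumes W: "subspace W" and S: "S \<noteq> {}" "S \<subseteq> x +o W"
  shows "S + W = x +o W"
proof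
  show "S + W \<subseteq> x +o W"
  proof
    fix t assume "t \<in> S + W"
    then obtain s w where "s \<in> S" and w: "w \<in> W" and t: "t = s + w"
      by (auto simp: set_plus_def)
    with S obtain u where "u \<in> W" "s = x + u"
      by (auto simp: elt_set_plus_def)
    with t w subspace_add[OF W] show "t \<in> x +o W"
      by (auto simp: elt_set_plus_def add.assoc)
  qed
  show "x +o W \<subseteq> S + W"
  proof
    fix t assume "t \<in> x +o W"
    then obtain w where w: "w \<in> W" "t = x + w"
      by (auto simp: elt_set_plus_def)
    from S obtain u where u: "u \<in> W" "x + u \<in> S"
      by (auto simp: elt_set_plus_def)
    have "t = (x + u) + (w - u)"
      using w by simp
    with u w subspace_diff[OF W] show "t \<in> S + W"
      unfolding set_plus_def by blast
  qed
qed

lemma sum_part_of_coset: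
  assumes W: "subspace W" and S: "\<And>a. a \<in> I \<Longrightarrow> S a \<noteq> {} \<and> S a \<subseteq> x a +o W"
  shows "sum S I \<noteq> {} \<and> sum S I \<subseteq> sum x I +o W"
  using S
proof (induction I rule: infinite_finite_induct)
  case (insert a I)
  then have IH: "sum S I \<noteq> {}" "sum S I \<subseteq> sum x I +o W" and Sa: "S a \<noteq> {}" "S a \<subseteq> x a +o W"
    by auto
  have "S a + sum S I \<noteq> {}"
    using IH(1) Sa(1) by (auto simp: set_plus_def)
  moreover have "S a + sum S I \<subseteq> (x a +o W) + (sum x I +o W)"
    using IH(2) Sa(2) by (rule set_plus_mono2[rotated])
  moreover have "(x a +o W) + (sum x I +o W) = (x a + sum x I) +o (W + W)"
    by (simp add: set_plus_rearrange)
  moreover have "W + W \<subseteq> W"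
    using subspace_add[OF W] by (auto simp: set_plus_def)
  then have "(x a + sum x I) +o (W + W) \<subseteq> (x a + sum x I) +o W"
    by (rule set_plus_mono)
  ultimately show ?case
    using insert.hyps by auto
qed (auto simp: subspace_0[OF W] elt_set_plus_def)

lemma times_part_of_coset:
  assumes x: "x \<in> Fge a" and y: "y \<in> Fge c"
  shows "(x +o Fgt a) * (y +o Fgt c) \<noteq> {} \<and>
         (x +o Fgt a) * (y +o Fgt c) \<subseteq> x * y +o Fgt (a + c)"
proof (intro conjI subsetI)
  show "(x +o Fgt a) * (y +o Fgt c) \<noteq> {}"
    using zero_in_F(2) unfolding elt_set_plus_def set_times_def by blast
  fix t assume "t \<in> (x +o Fgt a) * (y +o Fgt c)"
  then obtain u w where u: "u \<in> Fgt a" and w: "w \<in> Fgt c" and t: "t = (x + u) * (y + w)"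
    by (auto simp: elt_set_plus_def set_times_def)
  have "(x * w + u * y) + u * w \<in> Fgt (a + c)"
    using x y u w Fgt_subset_Fge
    by (intro subspace_add[OF subspace_Fgt])
      (auto intro: Fge_Fgt_mult Fgt_Fge_mult)
  moreover have "t = x * y + ((x * w + u * y) + u * w)"
    using t by (simp add: algebra_simps)
  ultimately show "t \<in> x * y +o Fgt (a + c)"
    unfolding elt_set_plus_def by blast
qed

abbreviation "gr \<equiv> gr_algebra leq lt scl v"

lemma gr_zero: "zero gr = coset_family (\<lambda>_. 0)"
  by (simp add: gr_algebra_def coset_family_def)

lemma gr_one: "one gr = gr_class lt v 0 1"
  by (simp add: gr_algebra_def)

lemma gr_add: "add gr (coset_family x) (coset_family y) = coset_family (\<lambda>d. x d + y d)"
proof -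
  have "(x d +o Fgt d) + (y d +o Fgt d) = (x d + y d) +o Fgt d" for d
    using part_of_coset_plus[OF subspace_Fgt, of "Fgt d" 0 d] zero_in_F
    by (auto simp: set_plus_rearrange)
  then show ?thesis
    by (simp add: gr_algebra_def coset_family_def)
qed

lemma gr_smult: "smult gr c (coset_family x) = coset_family (\<lambda>d. scl c (x d))"
proof -
  have "scl c ` (x d +o Fgt d) + Fgt d = scl c (x d) +o Fgt d" for d
  proof (rule part_of_coset_plus[OF subspace_Fgt])
    show "scl c ` (x d +o Fgt d) \<noteq> {}"
      using zero_in_F by (auto simp: elt_set_plus_def)
    show "scl c ` (x d +o Fgt d) \<subseteq> scl c (x d) +o Fgt d"
      using subspace_scale[OF subspace_Fgt]
      by (auto simp: elt_set_plus_def scale_right_distrib)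
  qed
  then show ?thesis
    by (simp add: gr_algebra_def coset_family_def)
qed

text \<open>
  In each degree the product of two cosets is part of the coset of the product of their
  representatives. When the support of \<open>x\<close> is infinite, both sums are zero by convention.
\<close>

lemma gr_mult:
  assumes "\<And>d. x d \<in> Fge d" "\<And>d. y d \<in> Fge d"
  shows "mult gr (coset_family x) (coset_family y)
    = coset_family (\<lambda>d. \<Sum>a | x a \<notin> Fgt a. x a * y (d - a))"
proof -
  have "(\<Sum>a | x a \<notin> Fgt a. coset_family x a * coset_family y (d - a)) + Fgt d
     = (\<Sum>a | x a \<notin> Fgt a. x a * y (d - a)) +o Fgt d" for d
  proof -
    have "coset_family x a * coset_family y (d - a) \<noteq> {} \<and>
        coset_family x a * coset_family y (d - a) \<subseteq> x a * y (d - a) +o Fgt d" for a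
      using times_part_of_coset[OF assms(1)[of a] assms(2)[of "d - a"]]
      by (simp add: coset_family_def)
    then show ?thesis
      using sum_part_of_coset[OF subspace_Fgt,
          of "{a. x a \<notin> Fgt a}" "\<lambda>a. coset_family x a * coset_family y (d - a)"
            "\<lambda>a. x a * y (d - a)" d]
      by (intro part_of_coset_plus[OF subspace_Fgt]) simp_all
  qed
  then show ?thesis
    by (simp add: gr_algebra_def coset_family_eq_zero_iff)
      (simp add: coset_family_def)
qed

lemma carrier_gr:
  "carrier gr = {coset_family x | x. (\<forall>d. x d \<in> Fge d) \<and> finite {d. x d \<notin> Fgt d}}"
    (is "_ = ?R")
proof
  show "carrier gr \<subseteq> ?R"
  proof
    fix X assume X: "X \<in> carrier gr"
    then have "\<forall>d. \<exists>f. f \<in> Fge d \<and> X d = f +o Fgt d"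
      by (auto simp: gr_algebra_def gr_component_def)
    then obtain x where x: "\<And>d. x d \<in> Fge d" "\<And>d. X d = x d +o Fgt d"
      by metis
    then have "X = coset_family x"
      by (auto simp: coset_family_def)
    with X x(1) show "X \<in> ?R"
      by (auto simp: gr_algebra_def coset_family_eq_zero_iff)
  qed
  show "?R \<subseteq> carrier gr"
    by (auto simp: gr_algebra_def coset_family_eq_zero_iff)
      (auto simp: gr_component_def coset_family_def)
qed

lemma gr_class_in_carrier: "f \<in> Fge a \<Longrightarrow> gr_class lt v a f \<in> carrier gr"
  unfolding carrier_gr gr_class_eq
  by (auto intro!: exI[of _ "\<lambda>d. if d = a then f else 0"] finite_subset[of _ "{a}"]
      simp: zero_in_F split: if_splits)

lemma gr_class_cong_iff: "gr_class lt v a f = gr_class lt v a g \<longleftrightarrow> f - g \<in> Fgt a"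
  by (auto simp: gr_class_eq fun_eq_iff coset_family_cong_iff zero_in_F)

lemma gr_class_zero: "gr_class lt v a 0 = zero gr"
  by (simp add: gr_class_eq gr_zero)

lemma gr_class_add: "add gr (gr_class lt v a f) (gr_class lt v a g) = gr_class lt v a (f + g)"
  by (auto simp: gr_class_eq gr_add intro!: arg_cong[of _ _ coset_family])

lemma gr_class_smult: "smult gr c (gr_class lt v a f) = gr_class lt v a (scl c f)"
  by (auto simp: gr_class_eq gr_smult intro!: arg_cong[of _ _ coset_family])

lemma in_Fge_v: "f \<in> Fge (v f)"
  by (auto simp: F_ge_def)

lemma not_in_Fgt_v: "f \<noteq> 0 \<Longrightarrow> f \<notin> Fgt (v f)"
  by (auto simp: F_gt_def)

text \<open>
  Initial forms of nonzero elements multiply without cancellation because values add, so products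
  of initial forms can be followed through the products of the elements themselves.
\<close>

lemma initial_form_mult:
  assumes "f \<noteq> 0" "g \<noteq> 0"
  shows "mult gr (initial_form lt v f) (initial_form lt v g) = initial_form lt v (f * g)"
proof -
  let ?x = "\<lambda>d. if d = v f then f else 0" and ?y = "\<lambda>d. if d = v g then g else 0"
  have "{a. ?x a \<notin> Fgt a} = {v f}"
    using not_in_Fgt_v[OF assms(1)] by (auto simp: zero_in_F)
  moreover have "\<And>d. ?x d \<in> Fge d" "\<And>d. ?y d \<in> Fge d"
    by (simp_all add: in_Fge_v zero_in_F)
  ultimately have "mult gr (coset_family ?x) (coset_family ?y)
      = coset_family (\<lambda>d. f * ?y (d - v f))"
    by (simp add: gr_mult)
  also have "\<dots> = coset_family (\<lambda>d. if d = v f + v g then f * g else 0)"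
    by (intro arg_cong[of _ _ coset_family]) (auto simp: fun_eq_iff algebra_simps)
  finally show ?thesis
    by (simp add: initial_form_def gr_class_eq v_mult assms)
qed

lemma initial_form_one: "initial_form lt v 1 = one gr"
  by (simp add: initial_form_def gr_one v_one)

lemma initial_form_power:
  "f \<noteq> 0 \<Longrightarrow> initial_form lt v f [^]\<^bsub>gr\<^esub> (m::nat) = initial_form lt v (f ^ m)"
  by (induction m) (simp_all add: nat_pow_def initial_form_one initial_form_mult mult.commute)

lemma initial_form_in_carrier: "initial_form lt v f \<in> carrier gr"
  by (simp add: initial_form_def gr_class_in_carrier in_Fge_v)

end


section \<open>Monomials and polynomials in a family of nonzero elements\<close>

text \<open>
  When all partial products are known in closed form, the order in which a finite product
  multiplies its factors cannot matter. The products and sums that evaluate a polynomial in the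
  graded algebra are of this kind, which avoids a proof of the ring axioms for families of cosets.
\<close>

lemma finprod_eq_of_insert:
  fixes G (structure)
  assumes fin: "finite A"
    and empty: "H {} = \<one>"
    and carr: "\<And>B. B \<subseteq> A \<Longrightarrow> H B \<in> carrier G"
    and ins: "\<And>x B. \<lbrakk>x \<in> A; B \<subseteq> A; x \<notin> B\<rbrakk> \<Longrightarrow> g x \<otimes> H B = H (insert x B)"
  shows "finprod G g A = H A"
proof -
  let ?F = "foldSetD (carrier G) (mult G \<circ> g) \<one>"
  have ex: "(B, H B) \<in> ?F" if "finite B" "B \<subseteq> A" for B
    using that
  proof (induction B rule: finite_induct)
    case empty
    show ?case
      using carr[of "{}"] unfolding assms(2) by (intro foldSetD.emptyI) simp
  next
    case (insert x B)
    then have "(insert x B, (mult G \<circ> g) x (H B)) \<in> ?F"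
      using ins[of x B] carr[of "insert x B"] by (intro foldSetD.insertI) auto
    moreover have "(mult G \<circ> g) x (H B) = H (insert x B)"
      using insert ins[of x B] by simp
    ultimately show ?case
      by (simp only:)
  qed
  have uniq: "X = H B" if "(B, X) \<in> ?F" "B \<subseteq> A" for B X
    using that by (induction rule: foldSetD.induct) (auto simp: empty ins)
  have "foldD (carrier G) (mult G \<circ> g) \<one> A = H A"
    unfolding foldD_def by (rule the_equality) (rule ex[OF fin] uniq, simp_all)+
  then show ?thesis
    using fin by (simp add: finprod_def)
qed

text \<open>
  Distinct exponents may give the same monomial in \<open>b\<close>, so an exponent has to be chosen for each
  element of the linear combination.
\<close>

lemma (in domain_algebra) span_monomials_poly_subst:
  fixes b :: "'n::finite \<Rightarrow> 'a"
  assumes "x \<in> span (monomial_in b ` E)"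
  shows "\<exists>p. Poly_Mapping.keys p \<subseteq> E \<and> poly_subst scl b p = x"
proof -
  obtain t u where t: "finite t" "t \<subseteq> monomial_in b ` E" and x: "x = (\<Sum>s\<in>t. scl (u s) s)"
    using assms unfolding span_explicit by auto
  obtain D where D: "D \<subseteq> E" "inj_on (monomial_in b) D" "t = monomial_in b ` D"
    using t(2) by (auto simp: subset_image_inj)
  have fin: "finite D"
    using t(1) D finite_image_iff by blast
  define c where "c \<alpha> = (if \<alpha> \<in> D then u (monomial_in b \<alpha>) else 0)" for \<alpha>
  define p where "p = Abs_poly_mapping c"
  have "finite {\<alpha>. c \<alpha> \<noteq> 0}"
    by (rule finite_subset[OF _ fin]) (auto simp: c_def)
  then have lookup: "Poly_Mapping.lookup p = c"
    by (simp add: p_def)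
  have keys: "Poly_Mapping.keys p \<subseteq> D"
    by (auto simp: in_keys_iff lookup c_def split: if_splits)
  have "poly_subst scl b p = (\<Sum>\<alpha>\<in>D. scl (c \<alpha>) (monomial_in b \<alpha>))"
    unfolding poly_subst_def lookup
    by (rule sum.mono_neutral_left[OF fin keys]) (auto simp: in_keys_iff lookup)
  also have "\<dots> = (\<Sum>\<alpha>\<in>D. scl (u (monomial_in b \<alpha>)) (monomial_in b \<alpha>))"
    by (rule sum.cong) (auto simp: c_def)
  also have "\<dots> = x"
    unfolding x D(3) by (simp add: sum.reindex[OF D(2)])
  finally show ?thesis
    using keys D(1) by blast
qed

locale valued_family = valuation leq lt scl v
  for leq lt :: "rat ^ 'r \<Rightarrow> rat ^ 'r \<Rightarrow> bool"
    and scl :: "'k::field \<Rightarrow> 'a::idom \<Rightarrow> 'a"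
    and v :: "'a \<Rightarrow> rat ^ 'r" +
  fixes b :: "'n::finite \<Rightarrow> 'a"
  assumes b_nonzero: "b i \<noteq> 0"
begin

lemma monomial_nonzero: "monomial_in b \<alpha> \<noteq> 0"
  by (simp add: monomial_in_def b_nonzero)

lemma monomial_mult: "monomial_in b \<alpha> * monomial_in b \<beta> = monomial_in b (\<alpha> + \<beta>)"
  by (simp add: monomial_in_def lookup_add power_add prod.distrib)

lemma monomial_zero: "monomial_in b 0 = 1"
  by (simp add: monomial_in_def)

lemma monomial_single: "monomial_in b (Poly_Mapping.single i 1) = b i"
proof -
  have "monomial_in b (Poly_Mapping.single i 1) = (\<Prod>j\<in>UNIV. if i = j then b j else 1)"
    unfolding monomial_in_def by (rule prod.cong) (auto simp: lookup_single when_def)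
  then show ?thesis
    by simp
qed

lemma v_monomial:
  assumes "\<And>i. column i M = v (b i)"
  shows "v (monomial_in b \<alpha>) = M *v (\<chi> i. of_nat (Poly_Mapping.lookup \<alpha> i))"
proof -
  have "M $ j $ i = v (b i) $ j" for i j
    using assms[of i] by (auto simp: column_def vec_eq_iff)
  then show ?thesis
    by (simp add: vec_eq_iff monomial_in_def v_prod b_nonzero v_power
        matrix_vector_mult_def mult.commute)
qed

lemma poly_subst_in_Fge:
  assumes "\<And>\<alpha>. \<alpha> \<in> Poly_Mapping.keys p \<Longrightarrow> leq a (v (monomial_in b \<alpha>))"
  shows "poly_subst scl b p \<in> Fge a"
  unfolding poly_subst_def
  by (intro subspace_sum[OF subspace_Fge] subspace_scale[OF subspace_Fge])
    (auto simp: F_ge_def assms)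

text \<open>
  For a polynomial all of whose monomials have the same value, evaluation commutes with passing to
  the graded algebra. This turns a pass of the subduction algorithm into a statement about \<open>v\<close>.
\<close>

lemma poly_subst_in_gr:
  fixes p :: "('n, 'k) mpoly"
  assumes p: "\<And>\<alpha>. \<alpha> \<in> Poly_Mapping.keys p \<Longrightarrow> v (monomial_in b \<alpha>) = d"
  shows "poly_subst_in gr (\<lambda>i. initial_form lt v (b i)) p = gr_class lt v d (poly_subst scl b p)"
proof -
  have monomial: "finprod gr (\<lambda>i. initial_form lt v (b i) [^]\<^bsub>gr\<^esub> Poly_Mapping.lookup \<alpha> i) UNIV
      = initial_form lt v (monomial_in b \<alpha>)" for \<alpha>
    unfolding monomial_in_def
    by (rule finprod_eq_of_insert
          [where H = "\<lambda>B. initial_form lt v (\<Prod>i\<in>B. b i ^ Poly_Mapping.lookup \<alpha> i)"])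
      (simp_all add: initial_form_in_carrier initial_form_one initial_form_power
        initial_form_mult b_nonzero)
  let ?t = "\<lambda>\<alpha>. scl (Poly_Mapping.lookup p \<alpha>) (monomial_in b \<alpha>)"
  have term_ge: "?t \<alpha> \<in> Fge d" if "\<alpha> \<in> Poly_Mapping.keys p" for \<alpha>
    using p[OF that] in_Fge_v subspace_scale[OF subspace_Fge] by metis
  have "finsum gr (\<lambda>\<alpha>. smult gr (Poly_Mapping.lookup p \<alpha>)
          (initial_form lt v (monomial_in b \<alpha>))) (Poly_Mapping.keys p)
      = gr_class lt v d (\<Sum>\<alpha>\<in>Poly_Mapping.keys p. ?t \<alpha>)"
    unfolding finsum_def
  proof (rule finprod_eq_of_insert[where H = "\<lambda>B. gr_class lt v d (\<Sum>\<alpha>\<in>B. ?t \<alpha>)"])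
    fix B assume "B \<subseteq> Poly_Mapping.keys p"
    then have "(\<Sum>\<alpha>\<in>B. ?t \<alpha>) \<in> Fge d"
      by (intro subspace_sum[OF subspace_Fge] term_ge) auto
    then show "gr_class lt v d (\<Sum>\<alpha>\<in>B. ?t \<alpha>) \<in> carrier (add_monoid gr)"
      by (simp add: gr_class_in_carrier)
  next
    fix \<alpha> B
    assume \<alpha>: "\<alpha> \<in> Poly_Mapping.keys p" "B \<subseteq> Poly_Mapping.keys p" "\<alpha> \<notin> B"
    then have "finite B"
      using finite_subset finite_keys by blast
    then show "smult gr (Poly_Mapping.lookup p \<alpha>) (initial_form lt v (monomial_in b \<alpha>))
        \<otimes>\<^bsub>add_monoid gr\<^esub> gr_class lt v d (\<Sum>\<alpha>\<in>B. ?t \<alpha>)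
        = gr_class lt v d (\<Sum>\<alpha>\<in>insert \<alpha> B. ?t \<alpha>)"
      using p[OF \<alpha>(1)] \<alpha>(3) by (simp add: initial_form_def gr_class_smult gr_class_add)
  qed (simp_all add: gr_class_zero)
  then show ?thesis
    by (simp add: poly_subst_in_def poly_subst_def monomial)
qed

definition monomials_of_value :: "rat ^ 'r \<Rightarrow> 'a set"
  where "monomials_of_value a = {m \<in> range (monomial_in b). v m = a}"

lemma b_in_monomials_of_value: "b i \<in> monomials_of_value (v (b i))"
  unfolding monomials_of_value_def using monomial_single[of i] by (metis (mono_tags) CollectI rangeI)

lemma one_in_monomials_of_value: "1 \<in> monomials_of_value 0"
  unfolding monomials_of_value_def using monomial_zero v_one by (metis (mono_tags) CollectI rangeI)

lemma mult_in_monomials_of_value: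
  "m \<in> monomials_of_value a \<Longrightarrow> m' \<in> monomials_of_value c \<Longrightarrow> m * m' \<in> monomials_of_value (a + c)"
  unfolding monomials_of_value_def by (auto simp: v_mult monomial_nonzero) (auto simp: monomial_mult)

lemma span_monomials_of_value_subset: "span (monomials_of_value a) \<subseteq> Fge a"
  by (rule span_minimal[OF _ subspace_Fge]) (auto simp: monomials_of_value_def F_ge_def)


section \<open>Subductive valuations have adapted bases of monomials\<close>

text \<open>
  Sums, products and multiples of families of cosets that are represented by combinations of
  monomials of the right values are again such families. So everything that the initial forms of
  the generators generate has this form, in particular the class of \<open>f\<close>.
\<close>

lemma khovanskii_basis_approximation:
  assumes kh: "khovanskii_basis leq lt scl v (range b)" and f: "f \<in> Fge a"
  shows "\<exists>x \<in> span (monomials_of_value a). f - x \<in> Fgt a"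
proof -
  have *: "\<exists>x. X = coset_family x \<and> (\<forall>d. x d \<in> span (monomials_of_value d))"
    if "X \<in> alg_generated gr (initial_form lt v ` range b)" for X
    using that
  proof induction
    case (incl X)
    then obtain i where "X = initial_form lt v (b i)"
      by auto
    then show ?case
      by (intro exI[of _ "\<lambda>d. if d = v (b i) then b i else 0"])
        (auto simp: initial_form_def gr_class_eq span_zero b_in_monomials_of_value intro: span_base)
  next
    case zero
    show ?case
      by (intro exI[of _ "\<lambda>_. 0"]) (simp add: gr_zero span_zero)
  next
    case one
    show ?case
      by (intro exI[of _ "\<lambda>d. if d = 0 then 1 else 0"])
        (auto simp: gr_one gr_class_eq span_zero one_in_monomials_of_value intro: span_base)
  next
    case (add X Y)
    then obtain x y where "X = coset_family x" "Y = coset_family y"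
      and "\<And>d. x d \<in> span (monomials_of_value d)" "\<And>d. y d \<in> span (monomials_of_value d)"
      by blast
    then show ?case
      by (intro exI[of _ "\<lambda>d. x d + y d"]) (simp add: gr_add span_add)
  next
    case (mult X Y)
    then obtain x y where X: "X = coset_family x" and Y: "Y = coset_family y"
      and x: "\<And>d. x d \<in> span (monomials_of_value d)"
      and y: "\<And>d. y d \<in> span (monomials_of_value d)"
      by blast
    have "x a * y (d - a) \<in> span (monomials_of_value d)" for a d
      using mult_in_monomials_of_value[of _ a _ "d - a"] by (intro span_times_span[OF x y]) simp
    then have "(\<Sum>a | x a \<notin> Fgt a. x a * y (d - a)) \<in> span (monomials_of_value d)" for d
      by (intro span_sum)
    moreover have "mult gr X Y = coset_family (\<lambda>d. \<Sum>a | x a \<notin> Fgt a. x a * y (d - a))"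
      unfolding X Y using x y span_monomials_of_value_subset by (intro gr_mult) blast+
    ultimately show ?case
      by blast
  next
    case (smult X c)
    then obtain x where "X = coset_family x" "\<And>d. x d \<in> span (monomials_of_value d)"
      by blast
    then show ?case
      by (intro exI[of _ "\<lambda>d. scl c (x d)"]) (simp add: gr_smult span_scale)
  qed
  obtain x where x: "gr_class lt v a f = coset_family x" "x a \<in> span (monomials_of_value a)"
    using *[of "gr_class lt v a f"] gr_class_in_carrier[OF f] kh
    unfolding khovanskii_basis_def by blast
  then have "f - x a \<in> Fgt a"
    using coset_family_cong_iff[of "\<lambda>d. if d = a then f else 0" a x] by (simp add: gr_class_eq)
  with x show ?thesis
    by blast
qed

text \<open>
  These monomials represent a basis of the image of the monomials of value \<open>a\<close> in the degree \<open>a\<close>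
  part of the graded algebra; the quotient is avoided by working in the span together with \<open>Fgt a\<close>.
  They are obtained by extending a basis of \<open>Fgt a\<close> by monomials.
\<close>

lemma exists_monomials_independent_mod_Fgt:
  obtains T where "T \<subseteq> monomials_of_value a"
    "\<And>x. x \<in> T \<Longrightarrow> x \<notin> span (Fgt a \<union> (T - {x}))"
    "monomials_of_value a \<subseteq> span (Fgt a \<union> T)"
proof -
  obtain C where C: "C \<subseteq> Fgt a" "independent C" "Fgt a \<subseteq> span C"
    using maximal_independent_subset_extend[OF empty_subsetI independent_empty, of "Fgt a"] by metis
  obtain B where B: "C \<subseteq> B" "B \<subseteq> C \<union> monomials_of_value a" "independent B"
      "C \<union> monomials_of_value a \<subseteq> span B"
    using maximal_independent_subset_extend[OF Un_upper1 C(2)] by metis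
  show ?thesis
  proof
    show "B - C \<subseteq> monomials_of_value a"
      using B by auto
    show "x \<notin> span (Fgt a \<union> (B - C - {x}))" if x: "x \<in> B - C" for x
    proof -
      have "Fgt a \<subseteq> span (B - {x})"
        using C(3) span_mono[of C "B - {x}"] B(1) x by blast
      moreover have "B - C - {x} \<subseteq> span (B - {x})"
        by (auto intro: span_base)
      ultimately have "span (Fgt a \<union> (B - C - {x})) \<subseteq> span (B - {x})"
        by (intro span_minimal) auto
      with B(3) x show ?thesis
        unfolding dependent_def by blast
    qed
    have "span B \<subseteq> span (Fgt a \<union> (B - C))"
      using C(1) by (intro span_mono) auto
    with B(4) show "monomials_of_value a \<subseteq> span (Fgt a \<union> (B - C))"
      by blast
  qed
qed

lemma subduction_stepI:
  assumes "f \<noteq> 0" "\<And>\<alpha>. \<alpha> \<in> Poly_Mapping.keys p \<Longrightarrow> v (monomial_in b \<alpha>) = v f"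
    and "f - poly_subst scl b p \<in> Fgt (v f)"
  shows "subduction_step leq lt scl v b f (f - poly_subst scl b p)"
proof -
  have "initial_form lt v f = gr_class lt v (v f) (poly_subst scl b p)"
    unfolding initial_form_def gr_class_cong_iff by fact
  also have "\<dots> = poly_subst_in gr (\<lambda>i. initial_form lt v (b i)) p"
    using poly_subst_in_gr[of p "v f"] assms(2) by simp
  finally show ?thesis
    unfolding subduction_step_def using assms by blast
qed

text \<open>
  In a linear relation, let \<open>z\<close> have least value among the elements with nonzero coefficient.
  The other elements of this value lie in \<open>T (v z)\<close> and the rest in \<open>Fgt (v z)\<close>, so solving for \<open>z\<close>
  contradicts the independence of \<open>T (v z)\<close> modulo \<open>Fgt (v z)\<close>.
\<close>

lemma independent_Union_graded:
  assumes T: "\<And>a. T a \<subseteq> monomials_of_value a"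
    "\<And>a x. x \<in> T a \<Longrightarrow> x \<notin> span (Fgt a \<union> (T a - {x}))"
  shows "independent (\<Union>a. T a)"
  unfolding independent_explicit_module
proof (intro allI impI, rule ccontr)
  fix t u x
  assume t: "finite t" "t \<subseteq> (\<Union>a. T a)" "(\<Sum>y\<in>t. scl (u y) y) = 0" and x: "x \<in> t" "u x \<noteq> 0"
  define t' where "t' = {y \<in> t. u y \<noteq> 0}"
  have t': "finite t'" "t' \<noteq> {}"
    using t x by (auto simp: t'_def)
  have "linorder.Min leq (v ` t') \<in> v ` t'"
    using t' by (intro linorder.Min_in[OF linorder_axioms]) auto
  then obtain z where z_min: "z \<in> t'" "linorder.Min leq (v ` t') = v z"
    by blast
  have z: "z \<in> t'" "\<And>y. y \<in> t' \<Longrightarrow> leq (v z) (v y)"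
    using z_min t' linorder.Min_le[OF linorder_axioms, of "v ` t'"] by auto
  have graded: "y \<in> T (v y) \<and> y \<noteq> 0" if "y \<in> t'" for y
    using that t(2) T(1) monomial_nonzero by (force simp: t'_def monomials_of_value_def)
  let ?U = "Fgt (v z) \<union> (T (v z) - {z})"
  have "y \<in> ?U" if "y \<in> t' - {z}" for y
    using graded[of y] z(2)[of y] that by (auto simp: F_gt_def le_less)
  then have "(\<Sum>y\<in>t' - {z}. scl (u y) y) \<in> span ?U"
    by (intro span_sum span_scale span_base)
  moreover have "(\<Sum>y\<in>t'. scl (u y) y) = 0"
    using t(1,3) sum.mono_neutral_right[of t t' "\<lambda>y. scl (u y) y"] by (auto simp: t'_def)
  then have "scl (u z) z = - (\<Sum>y\<in>t' - {z}. scl (u y) y)"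
    using sum.remove[OF t'(1) z(1), of "\<lambda>y. scl (u y) y"] by (simp add: eq_neg_iff_add_eq_0)
  ultimately have "scl (inverse (u z)) (scl (u z) z) \<in> span ?U"
    by (simp add: span_neg span_scale del: scale_scale)
  then have "z \<in> span ?U"
    using z(1) by (simp add: t'_def)
  with T(2) graded[OF z(1)] show False
    by blast
qed

theorem subductive_imp_adapted_basis:
  assumes "subductive leq lt scl v b"
  shows "\<exists>S. adapted_basis leq scl v S \<and> S \<subseteq> range (monomial_in b)"
proof -
  have kh: "khovanskii_basis leq lt scl v (range b)"
    and terminates: "\<And>s. s 0 \<noteq> 0 \<Longrightarrow> \<not> (\<forall>m::nat. subduction_step leq lt scl v b (s m) (s (Suc m)))"
    using assms by (auto simp: subductive_def)
  have "\<forall>a. \<exists>T. T \<subseteq> monomials_of_value a \<and>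
      (\<forall>x\<in>T. x \<notin> span (Fgt a \<union> (T - {x}))) \<and> monomials_of_value a \<subseteq> span (Fgt a \<union> T)"
    using exists_monomials_independent_mod_Fgt by metis
  then obtain T where T: "\<And>a. T a \<subseteq> monomials_of_value a"
      "\<And>a x. x \<in> T a \<Longrightarrow> x \<notin> span (Fgt a \<union> (T a - {x}))"
      "\<And>a. monomials_of_value a \<subseteq> span (Fgt a \<union> T a)"
    by metis
  define S where "S = (\<Union>a. T a)"
  have indep: "independent S"
    unfolding S_def by (rule independent_Union_graded[OF T(1,2)])
  have S_monomials: "S \<subseteq> range (monomial_in b)"
    using T(1) by (auto simp: S_def monomials_of_value_def)
  \<comment> \<open>A pass that only uses monomials in \<open>S\<close> subtracts an element of the span, so the remainder
    of a counterexample to spanning is again a counterexample.\<close>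
  have next_remainder: "\<exists>h. h \<in> Fge a \<and> h \<notin> span (Fge a \<inter> S) \<and> subduction_step leq lt scl v b g h"
    if g: "g \<in> Fge a" "g \<notin> span (Fge a \<inter> S)" for a g
  proof -
    have g0: "g \<noteq> 0"
      using g span_zero by auto
    then have le: "leq a (v g)"
      using g(1) by (simp add: F_ge_def)
    obtain x where x: "x \<in> span (monomials_of_value (v g))" "g - x \<in> Fgt (v g)"
      using khovanskii_basis_approximation[OF kh in_Fge_v] by blast
    have "span (monomials_of_value (v g)) \<subseteq> span (Fgt (v g) \<union> T (v g))"
      by (intro span_minimal T(3)) simp
    then have "(g - x) + x \<in> span (Fgt (v g) \<union> T (v g))"
      using x by (intro span_add) (auto intro: span_base)
    then obtain w y where w: "w \<in> Fgt (v g)" and y: "y \<in> span (T (v g))" and gwy: "g = w + y"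
      using subspace_Fgt[of "v g"] by (auto simp: span_Un simp flip: span_eq_iff)
    have "T (v g) = monomial_in b ` {\<alpha>. monomial_in b \<alpha> \<in> T (v g)}"
      using T(1)[of "v g"] by (auto simp: monomials_of_value_def)
    then obtain p where p: "Poly_Mapping.keys p \<subseteq> {\<alpha>. monomial_in b \<alpha> \<in> T (v g)}"
        "poly_subst scl b p = y"
      using span_monomials_poly_subst y by metis
    have "subduction_step leq lt scl v b g (g - poly_subst scl b p)"
      using g0 p w gwy T(1) by (intro subduction_stepI) (auto simp: monomials_of_value_def)
    moreover have w_ge: "w \<in> Fge a"
      using w Fgt_subset_Fge Fge_antimono[OF le] by blast
    moreover have "w \<notin> span (Fge a \<inter> S)"
    proof
      assume "w \<in> span (Fge a \<inter> S)"
      moreover have "T (v g) \<subseteq> Fge a \<inter> S"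
        using T(1)[of "v g"] le by (auto simp: S_def monomials_of_value_def F_ge_def)
      then have "y \<in> span (Fge a \<inter> S)"
        using y span_mono by blast
      ultimately show False
        using g(2) gwy span_add by blast
    qed
    ultimately show ?thesis
      using gwy p by auto
  qed
  have span_ge: "Fge a \<subseteq> span (Fge a \<inter> S)" for a
  proof (rule ccontr)
    assume "\<not> Fge a \<subseteq> span (Fge a \<inter> S)"
    then obtain f where f: "f \<in> Fge a" "f \<notin> span (Fge a \<inter> S)"
      by blast
    have "\<exists>s. \<forall>m. (s m \<in> Fge a \<and> s m \<notin> span (Fge a \<inter> S)) \<and>
        subduction_step leq lt scl v b (s m) (s (Suc m))"
      using f next_remainder by (intro dependent_nat_choice) blast+
    then obtain s where s: "\<And>m. s m \<notin> span (Fge a \<inter> S)"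
        "\<And>m. subduction_step leq lt scl v b (s m) (s (Suc m))"
      by blast
    then have "s 0 \<noteq> 0"
      using span_zero by metis
    with terminates s(2) show False
      by blast
  qed
  have "span (Fge a \<inter> S) = Fge a" for a
    using span_ge[of a] span_minimal[OF Int_lower1 subspace_Fge] by blast
  moreover have "independent (Fge a \<inter> S)" for a
    using indep by (rule independent_mono) auto
  moreover have "f \<in> span S" for f
    using span_ge[of "v f"] in_Fge_v[of f] span_mono[of "Fge (v f) \<inter> S" S] by blast
  ultimately have "adapted_basis leq scl v S"
    using indep by (auto simp: adapted_basis_def vs_basis_def)
  with S_monomials show ?thesis
    by blast
qed


section \<open>Adapted bases of monomials determine the weight valuation\<close>

lemma weight_poly_eq:
  assumes "\<And>i. column i M = v (b i)"
  shows "weight_poly leq M p = linorder.Min leq ((\<lambda>\<alpha>. v (monomial_in b \<alpha>)) ` Poly_Mapping.keys p)"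
  unfolding weight_poly_def by (simp add: v_monomial[OF assms])

lemma weight_poly_le_monomial:
  assumes "\<And>i. column i M = v (b i)" and "\<alpha> \<in> Poly_Mapping.keys p"
  shows "leq (weight_poly leq M p) (v (monomial_in b \<alpha>))"
  unfolding weight_poly_eq[OF assms(1)]
  using assms(2) by (intro linorder.Min_le[OF linorder_axioms]) auto

lemma weight_poly_attained:
  assumes "\<And>i. column i M = v (b i)" and "poly_subst scl b p \<noteq> 0"
  obtains \<alpha> where "\<alpha> \<in> Poly_Mapping.keys p" "weight_poly leq M p = v (monomial_in b \<alpha>)"
proof -
  have "Poly_Mapping.keys p \<noteq> {}"
    using assms(2) by (auto simp: poly_subst_def)
  then have "weight_poly leq M p \<in> (\<lambda>\<alpha>. v (monomial_in b \<alpha>)) ` Poly_Mapping.keys p"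
    unfolding weight_poly_eq[OF assms(1)] by (intro linorder.Min_in[OF linorder_axioms]) auto
  with that show ?thesis
    by blast
qed

text \<open>
  The maximum is attained at the expansion of \<open>f\<close> in the part of \<open>S\<close> that spans \<open>Fge (v f)\<close>:
  there cancellation of terms below \<open>v f\<close> cannot occur because there are none.
\<close>

theorem adapted_basis_imp_weight_val:
  assumes M: "\<And>i. column i M = v (b i)"
    and S: "adapted_basis leq scl v S" "S \<subseteq> range (monomial_in b)" and f: "f \<noteq> 0"
  shows "weight_val_is leq scl b M f (v f)"
proof -
  have upper: "leq (weight_poly leq M p) (v f)" if "poly_subst scl b p = f" for p
    using poly_subst_in_Fge[of p, OF weight_poly_le_monomial[OF M]] that f
    by (auto simp: F_ge_def)
  have "f \<in> span (Fge (v f) \<inter> S)"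
    using S(1) in_Fge_v[of f] by (simp add: adapted_basis_def vs_basis_def)
  moreover have "Fge (v f) \<inter> S \<subseteq> monomial_in b ` {\<alpha>. leq (v f) (v (monomial_in b \<alpha>))}"
    using S(2) monomial_nonzero by (auto simp: F_ge_def)
  ultimately have "f \<in> span (monomial_in b ` {\<alpha>. leq (v f) (v (monomial_in b \<alpha>))})"
    using span_mono by blast
  then obtain p where p: "\<And>\<alpha>. \<alpha> \<in> Poly_Mapping.keys p \<Longrightarrow> leq (v f) (v (monomial_in b \<alpha>))"
      "poly_subst scl b p = f"
    using span_monomials_poly_subst by blast
  obtain \<alpha> where "\<alpha> \<in> Poly_Mapping.keys p" "weight_poly leq M p = v (monomial_in b \<alpha>)"
    using weight_poly_attained[OF M] p(2) f by metis
  then have "weight_poly leq M p = v f"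
    using upper[OF p(2)] p(1) by (simp add: order.antisym antisym)
  with p(2) upper show ?thesis
    unfolding weight_val_is_def by (auto intro!: exI[of _ p])
qed


section \<open>Weight valuations have Khovanskii bases\<close>

text \<open>
  The operations on families of cosets are defined for all functions; what has to be checked is
  that they preserve the degrees and the finiteness of the support.
\<close>

lemma alg_generated_subset_carrier:
  "alg_generated gr (initial_form lt v ` range b) \<subseteq> carrier gr"
proof
  fix X assume "X \<in> alg_generated gr (initial_form lt v ` range b)"
  then show "X \<in> carrier gr"
  proof induction
    case (incl X)
    then show ?case
      by (auto simp: initial_form_in_carrier)
  next
    case zero
    show ?case
      using gr_class_in_carrier[OF zero_in_F(1)] by (simp add: gr_class_zero)
  next
    case one
    show ?case
      using initial_form_in_carrier[of 1] by (simp add: initial_form_one)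
  next
    case (add X Y)
    then obtain x y where X: "X = coset_family x" "\<And>d. x d \<in> Fge d" "finite {d. x d \<notin> Fgt d}"
      and Y: "Y = coset_family y" "\<And>d. y d \<in> Fge d" "finite {d. y d \<notin> Fgt d}"
      unfolding carrier_gr by blast
    have "finite {d. x d + y d \<notin> Fgt d}"
      by (rule finite_subset[OF _ finite_UnI[OF X(3) Y(3)]]) (auto intro: subspace_add[OF subspace_Fgt])
    then show ?case
      unfolding carrier_gr X(1) Y(1) gr_add using X(2) Y(2) subspace_add[OF subspace_Fge] by blast
  next
    case (mult X Y)
    then obtain x y where X: "X = coset_family x" "\<And>d. x d \<in> Fge d" "finite {d. x d \<notin> Fgt d}"
      and Y: "Y = coset_family y" "\<And>d. y d \<in> Fge d" "finite {d. y d \<notin> Fgt d}"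
      unfolding carrier_gr by blast
    let ?z = "\<lambda>d. \<Sum>a | x a \<notin> Fgt a. x a * y (d - a)"
    have ge: "?z d \<in> Fge d" for d
    proof (rule subspace_sum[OF subspace_Fge])
      show "x a * y (d - a) \<in> Fge d" for a
        using Fge_mult[OF X(2)[of a] Y(2)[of "d - a"]] by simp
    qed
    \<comment> \<open>A degree of the product is a sum of degrees of the factors.\<close>
    have "\<exists>a. x a \<notin> Fgt a \<and> y (d - a) \<notin> Fgt (d - a)" if "?z d \<notin> Fgt d" for d
    proof (rule ccontr)
      assume "\<nexists>a. x a \<notin> Fgt a \<and> y (d - a) \<notin> Fgt (d - a)"
      then have "x a * y (d - a) \<in> Fgt d" if "x a \<notin> Fgt a" for a
        using Fge_Fgt_mult[OF X(2), of "y (d - a)" "d - a" a] that by auto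
      then have "?z d \<in> Fgt d"
        by (intro subspace_sum[OF subspace_Fgt]) simp
      with that show False
        by blast
    qed
    then have "{d. ?z d \<notin> Fgt d}
        \<subseteq> (\<lambda>(a, c). a + c) ` ({a. x a \<notin> Fgt a} \<times> {c. y c \<notin> Fgt c})"
      by (force simp: image_iff)
    then have "finite {d. ?z d \<notin> Fgt d}"
      using X(3) Y(3) finite_subset by blast
    then show ?case
      unfolding carrier_gr X(1) Y(1) gr_mult[OF X(2) Y(2)] using ge by blast
  next
    case (smult X c)
    then obtain x where X: "X = coset_family x" "\<And>d. x d \<in> Fge d" "finite {d. x d \<notin> Fgt d}"
      unfolding carrier_gr by blast
    have "finite {d. scl c (x d) \<notin> Fgt d}"
      by (rule finite_subset[OF _ X(3)]) (auto intro: subspace_scale[OF subspace_Fgt])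
    then show ?case
      unfolding carrier_gr X(1) gr_smult using X(2) subspace_scale[OF subspace_Fge] by blast
  qed
qed

lemma initial_form_monomial_generated:
  "initial_form lt v (monomial_in b \<alpha>) \<in> alg_generated gr (initial_form lt v ` range b)"
    (is "_ \<in> ?A")
proof -
  have one: "initial_form lt v 1 \<in> ?A"
    by (simp add: initial_form_one alg_generated.one)
  have power: "initial_form lt v (b i ^ m) \<in> ?A" for i m
  proof (induction m)
    case (Suc m)
    have "mult gr (initial_form lt v (b i)) (initial_form lt v (b i ^ m)) \<in> ?A"
      by (rule alg_generated.mult[OF alg_generated.incl Suc.IH]) simp
    then show ?case
      by (simp add: initial_form_mult b_nonzero)
  qed (simp add: one)
  have "initial_form lt v (\<Prod>i\<in>I. b i ^ Poly_Mapping.lookup \<alpha> i) \<in> ?A" for I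
  proof (induction I rule: infinite_finite_induct)
    case (insert i I)
    then have "mult gr (initial_form lt v (b i ^ Poly_Mapping.lookup \<alpha> i))
        (initial_form lt v (\<Prod>i\<in>I. b i ^ Poly_Mapping.lookup \<alpha> i)) \<in> ?A"
      by (intro alg_generated.mult[OF power insert.IH])
    then show ?case
      using insert.hyps by (simp add: initial_form_mult b_nonzero)
  qed (simp_all add: one)
  then show ?thesis
    by (simp add: monomial_in_def)
qed

theorem weight_val_imp_khovanskii_basis:
  assumes M: "\<And>i. column i M = v (b i)"
    and weight: "\<And>f. f \<noteq> 0 \<Longrightarrow> weight_val_is leq scl b M f (v f)"
  shows "khovanskii_basis leq lt scl v (range b)"
proof -
  let ?A = "alg_generated gr (initial_form lt v ` range b)"
  have small: "gr_class lt v a f \<in> ?A" if "f \<in> Fgt a" for a f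
    using that gr_class_cong_iff[of a f 0] by (simp add: gr_class_zero alg_generated.zero)
  \<comment> \<open>The degree \<open>a\<close> need not be the value of the monomial: a term of larger value has class zero.\<close>
  have monomial_term: "gr_class lt v a (scl c (monomial_in b \<alpha>)) \<in> ?A"
    if "leq a (v (monomial_in b \<alpha>))" for a c \<alpha>
  proof (cases "a = v (monomial_in b \<alpha>)")
    case True
    then show ?thesis
      using alg_generated.smult[OF initial_form_monomial_generated, of c \<alpha>]
      by (simp add: initial_form_def gr_class_smult)
  next
    case False
    with that have "monomial_in b \<alpha> \<in> Fgt a"
      by (simp add: F_gt_def le_less)
    then show ?thesis
      by (intro small subspace_scale[OF subspace_Fgt])
  qed
  have homogeneous: "gr_class lt v a f \<in> ?A" if f: "f \<in> Fge a" for a f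
  proof (cases "f \<in> Fgt a")
    case True
    then show ?thesis
      by (rule small)
  next
    case False
    then have "f \<noteq> 0" "v f = a"
      using f by (auto simp: F_ge_def F_gt_def le_less)
    then obtain p where p: "poly_subst scl b p = f" "weight_poly leq M p = a"
      using weight[of f] by (auto simp: weight_val_is_def)
    have ge: "leq a (v (monomial_in b \<alpha>))" if "\<alpha> \<in> Poly_Mapping.keys p" for \<alpha>
      using weight_poly_le_monomial[OF M that] p(2) by simp
    have "gr_class lt v a (\<Sum>\<alpha>\<in>I. scl (Poly_Mapping.lookup p \<alpha>) (monomial_in b \<alpha>)) \<in> ?A"
      if "I \<subseteq> Poly_Mapping.keys p" for I
      using finite_subset[OF that finite_keys] that
    proof (induction I rule: finite_induct)
      case (insert \<alpha> I)
      then show ?case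
        using alg_generated.add[OF monomial_term[OF ge] insert.IH] by (simp add: gr_class_add)
    qed (simp add: gr_class_zero alg_generated.zero)
    then show ?thesis
      using p(1) by (auto simp: poly_subst_def)
  qed
  have "carrier gr \<subseteq> ?A"
  proof
    fix X assume "X \<in> carrier gr"
    then obtain x where X: "X = coset_family x"
      and x: "\<And>d. x d \<in> Fge d" and fin: "finite {d. x d \<notin> Fgt d}"
      unfolding carrier_gr by blast
    have "coset_family (\<lambda>d. if d \<in> D then x d else 0) \<in> ?A" if "finite D" for D
      using that
    proof (induction D rule: finite_induct)
      case (insert a D)
      have "add gr (gr_class lt v a (x a)) (coset_family (\<lambda>d. if d \<in> D then x d else 0)) \<in> ?A"
        using insert.IH homogeneous[OF x] by (intro alg_generated.add)
      also have "add gr (gr_class lt v a (x a)) (coset_family (\<lambda>d. if d \<in> D then x d else 0))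
          = coset_family (\<lambda>d. if d \<in> insert a D then x d else 0)"
        unfolding gr_class_eq gr_add using insert.hyps
        by (intro arg_cong[of _ _ coset_family]) auto
      finally show ?case .
    next
      case empty
      show ?case
        using alg_generated.zero[of gr] by (simp add: gr_zero)
    qed
    \<comment> \<open>Outside the support the representatives may be nonzero elements of \<open>Fgt d\<close>; replacing
      them by zero does not change the cosets.\<close>
    from this[OF fin] have "coset_family (\<lambda>d. if x d \<notin> Fgt d then x d else 0) \<in> ?A"
      by simp
    also have "coset_family (\<lambda>d. if x d \<notin> Fgt d then x d else 0) = X"
      unfolding X using zero_in_F(2) subspace_neg[OF subspace_Fgt]
      by (auto simp: fun_eq_iff coset_family_cong_iff)
    finally show "X \<in> ?A" .
  qed
  then show ?thesis
    unfolding khovanskii_basis_def using alg_generated_subset_carrier by blast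
qed

end

theorem lemma3:
  fixes leq lt :: "rat ^ 'r \<Rightarrow> rat ^ 'r \<Rightarrow> bool"
    and scl :: "'k::field \<Rightarrow> 'a::idom \<Rightarrow> 'a"
    and v :: "'a \<Rightarrow> rat ^ 'r"
    and b :: "'n::finite \<Rightarrow> 'a"
    and M :: "rat ^ 'n ^ 'r"
  assumes "valuation leq lt scl v"
    and "algebra_generating_set scl (range b)"
    and "\<And>i. b i \<noteq> 0"
    and "\<And>i. column i M = v (b i)"
  shows "(subductive leq lt scl v b \<longrightarrow>
            (\<exists>S. adapted_basis leq scl v S \<and> S \<subseteq> range (monomial_in b)))
       \<and> ((\<exists>S. adapted_basis leq scl v S \<and> S \<subseteq> range (monomial_in b)) \<longrightarrow>
            (\<forall>f. f \<noteq> 0 \<longrightarrow> weight_val_is leq scl b M f (v f)))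
       \<and> ((\<forall>f. f \<noteq> 0 \<longrightarrow> weight_val_is leq scl b M f (v f)) \<longrightarrow>
            khovanskii_basis leq lt scl v (range b))"
proof -
  interpret valuation leq lt scl v
    by fact
  interpret valued_family leq lt scl v b
    by unfold_locales fact
  show ?thesis
    using subductive_imp_adapted_basis adapted_basis_imp_weight_val[OF assms(4)]
      weight_val_imp_khovanskii_basis[OF assms(4)] by blast
qed

end
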